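(* Two directed graphs $G=(V,E)$ and $G'=(V',E')$ are isomorphic if and only if there exist a skeleton $\sigma=(\mathcal O,R,f)$ over $V$ and a skeleton $\tau=(\mathcal P,Q,g)$ over $V'$ that are companions and satisfy $G=G_\sigma$ and $G'=G_\tau$.
   Context: A directed graph $G=(V,E)$ has finite vertex set $V$ and $E\subseteq V\times V$. A skeleton over a finite set $V$ is a triple $\sigma=(\mathcal O,R,f)$ where $R\subseteq V$, $\mathcal O=\{O_z\mid z\in R\}$ is a family of subsets of $V$ indexed by $R$ with $O_z=O_{z'}$ iff $z=z'$ and $|\mathcal O|\le|V|$, and $f:V\to R$ is a surjection. The graph defined by $\sigma$ is $G_\sigma=(V,E)$ with $E=\{(x,w)\mid x\in V,\ w\in O_{f(x)}\}$. For a family $\mathcal O$, $\mathcal O^\cap$ is the smallest family containing $\mathcal O$ and closed under intersection of two sets. A faithful correspondence between $\mathcal O\subseteq 2^V$ and $\mathcal P\subseteq 2^W$ is a bijection $\eta:\mathcal O^\cap\to\mathcal P^\cap$ with $|X|=|\eta(X)|$ and $\eta(X\cap Y)=\eta(X)\cap\eta(Y)$ for all $X,Y\in\mathcal O^\cap$. Skeletons $\sigma=(\mathcal O,R,f)$ over $V$ and $\tau=(\mathcal P,Q,g)$ over $W$ are companions if there is a bijection $\eta:V\to W$ whose elementwise extension to subsets restricts to a faithful correspondence $\mathcal O^\cap\to\mathcal P^\cap$ and satisfies $\eta(O_{f(x)})=P_{g(\eta(x))}$ for all $x\in V$. *)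

theory Defs
  imports "Graph_Theory.Pair_Digraph" "Graph_Theory.Digraph_Isomorphism"
begin

text \<open>
  Directed graphs with finite vertex set \<open>V\<close> and \<open>E \<subseteq> V \<times> V\<close> are pair digraphs satisfying
  \<^locale>\<open>pair_fin_digraph\<close> (loops are allowed). \<^const>\<open>with_proj\<close> views such a graph as
  a general digraph whose arcs are pairs, so that \<^const>\<open>digraph_iso\<close> applies; the
  following lemma confirms that this is the usual notion of isomorphism.
\<close>

lemma digraph_iso_with_proj_iff:
  assumes "pair_fin_digraph G" "pair_fin_digraph H"
  shows "digraph_iso (with_proj G) (with_proj H) \<longleftrightarrow>
    (\<exists>\<phi>. bij_betw \<phi> (pverts G) (pverts H) \<and>
         (\<forall>x\<in>pverts G. \<forall>y\<in>pverts G. (x, y) \<in> parcs G \<longleftrightarrow> (\<phi> x, \<phi> y) \<in> parcs H))"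
    (is "?L \<longleftrightarrow> ?R")
proof -
  interpret G: pair_fin_digraph G by fact
  interpret H: pair_fin_digraph H by fact
  have GE: "x \<in> pverts G" "y \<in> pverts G" if "(x, y) \<in> parcs G" for x y
    using G.in_arcsD1[OF that] G.in_arcsD2[OF that] by auto
  have HE: "x \<in> pverts H" "y \<in> pverts H" if "(x, y) \<in> parcs H" for x y
    using H.in_arcsD1[OF that] H.in_arcsD2[OF that] by auto
  show ?thesis
  proof
    assume ?L
    then obtain f where f: "G.digraph_isomorphism f" and Heq: "with_proj H = app_iso f (with_proj G)"
      unfolding digraph_iso_def by blast
    have vH: "pverts H = iso_verts f ` pverts G" and aH: "parcs H = iso_arcs f ` parcs G"
      and tH: "iso_tail f = fst" and hH: "iso_head f = snd"
      using arg_cong[OF Heq, of verts] arg_cong[OF Heq, of arcs]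
        arg_cong[OF Heq, of tail] arg_cong[OF Heq, of head] by (auto simp: with_proj_def)
    have inj: "inj_on (iso_verts f) (pverts G)"
      using f by (simp add: G.digraph_isomorphism_def)
    have arc: "iso_arcs f (x, y) = (iso_verts f x, iso_verts f y)" if "(x, y) \<in> parcs G" for x y
      using f that unfolding G.digraph_isomorphism_def by (force simp: tH hH prod_eq_iff)
    have "(x, y) \<in> parcs G \<longleftrightarrow> (iso_verts f x, iso_verts f y) \<in> parcs H"
      if x: "x \<in> pverts G" and y: "y \<in> pverts G" for x y
    proof
      show "(iso_verts f x, iso_verts f y) \<in> parcs H" if "(x, y) \<in> parcs G"
        using arc[OF that] that unfolding aH by (metis imageI)
    next
      assume "(iso_verts f x, iso_verts f y) \<in> parcs H"
      then obtain u v where uv: "(u, v) \<in> parcs G"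
        "iso_arcs f (u, v) = (iso_verts f x, iso_verts f y)"
        unfolding aH by (metis imageE surj_pair)
      then have "u = x" "v = y" using arc[OF uv(1)] GE[OF uv(1)] x y inj
        by (auto dest: inj_onD)
      with uv show "(x, y) \<in> parcs G" by simp
    qed
    then show ?R using inj vH by (auto simp: bij_betw_def)
  next
    assume ?R
    then obtain \<phi> where b: "bij_betw \<phi> (pverts G) (pverts H)"
      and e: "\<And>x y. x \<in> pverts G \<Longrightarrow> y \<in> pverts G \<Longrightarrow> (x, y) \<in> parcs G \<longleftrightarrow> (\<phi> x, \<phi> y) \<in> parcs H"
      by blast
    define f where "f = \<lparr>iso_verts = \<phi>, iso_arcs = map_prod \<phi> \<phi>, iso_head = snd, iso_tail = fst\<rparr>"
    have inj: "inj_on \<phi> (pverts G)" using b by (rule bij_betw_imp_inj_on)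
    have img: "\<phi> ` pverts G = pverts H" using b by (rule bij_betw_imp_surj_on)
    have "inj_on (map_prod \<phi> \<phi>) (parcs G)"
      by (rule inj_on_subset[OF map_prod_inj_on[OF inj inj]]) (use GE in auto)
    then have "G.digraph_isomorphism f"
      unfolding G.digraph_isomorphism_def
      using inj G.wf_digraph by (auto simp: f_def)
    moreover have "map_prod \<phi> \<phi> ` parcs G = parcs H"
    proof (intro equalityI subsetI)
      fix p assume "p \<in> map_prod \<phi> \<phi> ` parcs G"
      then obtain x y where xy: "(x, y) \<in> parcs G" "p = (\<phi> x, \<phi> y)" by auto
      then show "p \<in> parcs H" using e[OF GE[OF xy(1)]] by blast
    next
      fix p assume p: "p \<in> parcs H"
      obtain u v where uv: "p = (u, v)" by (cases p)
      then have "u \<in> \<phi> ` pverts G" "v \<in> \<phi> ` pverts G" using HE[of u v] p img by blast+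
      then obtain x y where xy: "x \<in> pverts G" "y \<in> pverts G" "u = \<phi> x" "v = \<phi> y" by blast
      then have "(x, y) \<in> parcs G" using e[OF xy(1,2)] p uv by blast
      then show "p \<in> map_prod \<phi> \<phi> ` parcs G" unfolding uv xy by (rule map_prod_imageI)
    qed
    then have "with_proj H = app_iso f (with_proj G)"
      using img by (auto simp: f_def app_iso_def with_proj_def)
    ultimately show ?L unfolding digraph_iso_def by blast
  qed
qed

text \<open>
  A triple \<open>(\<O>, R, f)\<close>: \<open>sk_set \<sigma> z\<close> is \<open>O\<^sub>z\<close>, of which only the values at
  \<open>z \<in> R\<close> matter; likewise \<open>f\<close> matters only on \<open>V\<close>.
\<close>

record 'a skeleton =
  sk_set :: "'a \<Rightarrow> 'a set"
  sk_index :: "'a set"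
  sk_map :: "'a \<Rightarrow> 'a"

definition sk_family :: "'a skeleton \<Rightarrow> 'a set set" where
  "sk_family \<sigma> = sk_set \<sigma> ` sk_index \<sigma>"

definition is_skeleton :: "'a set \<Rightarrow> 'a skeleton \<Rightarrow> bool" where
  "is_skeleton V \<sigma> \<longleftrightarrow>
     finite V \<and>
     sk_index \<sigma> \<subseteq> V \<and>
     sk_family \<sigma> \<subseteq> Pow V \<and>
     (\<forall>z\<in>sk_index \<sigma>. \<forall>z'\<in>sk_index \<sigma>. sk_set \<sigma> z = sk_set \<sigma> z' \<longleftrightarrow> z = z') \<and>
     card (sk_family \<sigma>) \<le> card V \<and>
     sk_map \<sigma> ` V = sk_index \<sigma>"

definition skeleton_graph :: "'a set \<Rightarrow> 'a skeleton \<Rightarrow> 'a pair_pre_digraph" where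
  "skeleton_graph V \<sigma> =
     \<lparr>pverts = V, parcs = {(x, w). x \<in> V \<and> w \<in> sk_set \<sigma> (sk_map \<sigma> x)}\<rparr>"

inductive_set inter_closure :: "'a set set \<Rightarrow> 'a set set" for \<O> where
  base: "X \<in> \<O> \<Longrightarrow> X \<in> inter_closure \<O>"
| inter: "X \<in> inter_closure \<O> \<Longrightarrow> Y \<in> inter_closure \<O> \<Longrightarrow> X \<inter> Y \<in> inter_closure \<O>"

definition faithful_correspondence ::
    "('a set \<Rightarrow> 'b set) \<Rightarrow> 'a set set \<Rightarrow> 'b set set \<Rightarrow> bool" where
  "faithful_correspondence \<eta> \<O> \<P> \<longleftrightarrow>
     bij_betw \<eta> (inter_closure \<O>) (inter_closure \<P>) \<and>
     (\<forall>X\<in>inter_closure \<O>. card X = card (\<eta> X)) \<and>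
     (\<forall>X\<in>inter_closure \<O>. \<forall>Y\<in>inter_closure \<O>. \<eta> (X \<inter> Y) = \<eta> X \<inter> \<eta> Y)"

definition companions :: "'a set \<Rightarrow> 'a skeleton \<Rightarrow> 'b set \<Rightarrow> 'b skeleton \<Rightarrow> bool" where
  "companions V \<sigma> W \<tau> \<longleftrightarrow>
     (\<exists>\<eta>. bij_betw \<eta> V W \<and>
          faithful_correspondence (\<lambda>X. \<eta> ` X) (sk_family \<sigma>) (sk_family \<tau>) \<and>
          (\<forall>x\<in>V. \<eta> ` sk_set \<sigma> (sk_map \<sigma> x) = sk_set \<tau> (sk_map \<tau> (\<eta> x))))"

end

theory Submission
  imports Defs
begin

text \<open>
  Indexing the out-neighbourhoods of a graph by one representative vertex each gives a skeleton
  defining it. Since an isomorphism maps out-neighbourhoods to out-neighbourhoods, and images under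
  an injection commute with intersections and preserve cardinality, the same vertex bijection makes
  the two canonical skeletons companions. Conversely, the bijection witnessing companionship carries
  \<open>O\<^bsub>f(x)\<^esub>\<close>, which is the out-neighbourhood of \<open>x\<close>, onto that of its image.
\<close>

definition out_nbhd :: "'a pair_pre_digraph \<Rightarrow> 'a \<Rightarrow> 'a set" where
  "out_nbhd G x = {y. (x, y) \<in> parcs G}"

text \<open>The choice predicate depends on \<open>x\<close> only through
  \<open>out_nbhd G x\<close>, so vertices with equal out-neighbourhoods get literally the same
  representative.\<close>

definition out_rep :: "'a pair_pre_digraph \<Rightarrow> 'a \<Rightarrow> 'a" where
  "out_rep G x = (SOME y. y \<in> pverts G \<and> out_nbhd G y = out_nbhd G x)"

definition canonical_skeleton :: "'a pair_pre_digraph \<Rightarrow> 'a skeleton" where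
  "canonical_skeleton G =
     \<lparr>sk_set = out_nbhd G, sk_index = out_rep G ` pverts G, sk_map = out_rep G\<rparr>"

lemma out_rep:
  assumes "x \<in> pverts G"
  shows "out_rep G x \<in> pverts G" and "out_nbhd G (out_rep G x) = out_nbhd G x"
proof -
  have "out_rep G x \<in> pverts G \<and> out_nbhd G (out_rep G x) = out_nbhd G x"
    unfolding out_rep_def by (rule someI[where x = x]) (use assms in simp)
  then show "out_rep G x \<in> pverts G" and "out_nbhd G (out_rep G x) = out_nbhd G x"
    by auto
qed

lemma out_rep_cong: "out_nbhd G x = out_nbhd G y \<Longrightarrow> out_rep G x = out_rep G y"
  by (simp add: out_rep_def)

lemma out_nbhd_subset: "pair_wf_digraph G \<Longrightarrow> out_nbhd G x \<subseteq> pverts G"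
  by (auto simp: out_nbhd_def pair_wf_digraph.in_arcsD2)

text \<open>Restricting the index set to representatives loses no out-neighbourhood, because each
  vertex shares its own with its representative.\<close>

lemma sk_family_canonical_skeleton:
  "sk_family (canonical_skeleton G) = out_nbhd G ` pverts G"
  by (simp add: sk_family_def canonical_skeleton_def image_image out_rep)

lemma is_skeleton_canonical_skeleton:
  assumes "pair_fin_digraph G"
  shows "is_skeleton (pverts G) (canonical_skeleton G)"
proof -
  interpret pair_fin_digraph G by fact
  have "card (sk_family (canonical_skeleton G)) \<le> card (pverts G)"
    unfolding sk_family_canonical_skeleton by (rule card_image_le) simp
  moreover have "sk_family (canonical_skeleton G) \<subseteq> Pow (pverts G)"
    unfolding sk_family_canonical_skeleton
    using out_nbhd_subset[OF pair_wf_digraph_axioms] by auto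
  \<comment> \<open>Injectivity of the indexing: equal sets at the representatives mean equal
    out-neighbourhoods of \<open>x\<close> and \<open>y\<close>, which forces the same
    choice.\<close>
  moreover have "out_nbhd G (out_rep G x) = out_nbhd G (out_rep G y) \<longleftrightarrow> out_rep G x = out_rep G y"
    if "x \<in> pverts G" "y \<in> pverts G" for x y
    using that by (metis out_rep(2) out_rep_cong)
  ultimately show ?thesis
    unfolding is_skeleton_def
    by (simp add: canonical_skeleton_def image_subset_iff out_rep(1))
qed

lemma skeleton_graph_canonical_skeleton:
  assumes "pair_wf_digraph G"
  shows "skeleton_graph (pverts G) (canonical_skeleton G) = G"
proof -
  interpret pair_wf_digraph G by fact
  have "x \<in> pverts G \<and> w \<in> out_nbhd G (out_rep G x) \<longleftrightarrow> (x, w) \<in> parcs G" for x w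
    \<comment> \<open>Outside \<open>pverts G\<close> both sides fail, since no arc starts there.
      The definition is instantiated at \<open>x\<close> only, so that \<open>out_rep(2)\<close> can
      still rewrite the out-neighbourhood of the representative.\<close>
    by (cases "x \<in> pverts G") (auto simp: out_rep(2) out_nbhd_def[of G x] dest: in_arcsD1)
  then show ?thesis
    by (simp add: skeleton_graph_def canonical_skeleton_def)
qed

lemma inter_closure_subset_Pow:
  assumes "\<O> \<subseteq> Pow V"
  shows "inter_closure \<O> \<subseteq> Pow V"
proof
  fix X assume "X \<in> inter_closure \<O>"
  then show "X \<in> Pow V" by induction (use assms in auto)
qed

text \<open>All members of the closure lie in \<open>V\<close>, where \<open>f\<close> is injective,
  so taking images commutes with their intersections. Each inclusion then follows by induction on
  the generation of the closure.\<close>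

lemma inter_closure_image:
  assumes "inj_on f V" and "\<O> \<subseteq> Pow V"
  shows "inter_closure ((`) f ` \<O>) = (`) f ` inter_closure \<O>"
proof -
  have image_Int: "f ` (X \<inter> Y) = f ` X \<inter> f ` Y"
    if "X \<in> inter_closure \<O>" "Y \<in> inter_closure \<O>" for X Y
    using inter_closure_subset_Pow[OF assms(2)] that
    by (intro inj_on_image_Int[OF assms(1)]) auto
  have "Z \<in> (`) f ` inter_closure \<O>" if "Z \<in> inter_closure ((`) f ` \<O>)" for Z
    using that
  proof induction
    case (base Z)
    then obtain X where "X \<in> \<O>" "Z = f ` X" by (elim imageE)
    then show ?case by (simp only: inter_closure.base imageI)
  next
    case (inter Z Z')
    then obtain X Y where XY: "X \<in> inter_closure \<O>" "Y \<in> inter_closure \<O>"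
      and "Z = f ` X" "Z' = f ` Y"
      by (elim imageE)
    then have "Z \<inter> Z' = f ` (X \<inter> Y)" by (simp only: image_Int)
    then show ?case using inter_closure.inter[OF XY] by (rule image_eqI)
  qed
  moreover have "f ` X \<in> inter_closure ((`) f ` \<O>)" if "X \<in> inter_closure \<O>" for X
    using that
  proof induction
    case (base X)
    then show ?case by (intro inter_closure.base imageI)
  next
    case (inter X Y)
    then show ?case by (simp only: image_Int inter_closure.inter)
  qed
  ultimately show ?thesis by (intro equalityI subsetI) (auto elim!: imageE)
qed

text \<open>Injectivity on \<open>V\<close> makes the image map injective on \<open>Pow V\<close>,
  cardinality preserving and compatible with intersections. Hence, for companions, it remains to
  match the individual sets.\<close>

lemma faithful_correspondence_image:
  assumes "inj_on f V" and "\<O> \<subseteq> Pow V"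
  shows "faithful_correspondence ((`) f) \<O> ((`) f ` \<O>)"
proof -
  have sub: "inter_closure \<O> \<subseteq> Pow V" by (rule inter_closure_subset_Pow[OF assms(2)])
  have "inj_on ((`) f) (inter_closure \<O>)"
    using inj_on_image_Pow[OF assms(1)] sub by (rule inj_on_subset)
  moreover have "card X = card (f ` X)" if "X \<in> inter_closure \<O>" for X
    using that sub assms(1) by (metis PowD card_image inj_on_subset subsetD)
  moreover have "f ` (X \<inter> Y) = f ` X \<inter> f ` Y"
    if "X \<in> inter_closure \<O>" "Y \<in> inter_closure \<O>" for X Y
    using sub that by (intro inj_on_image_Int[OF assms(1)]) auto
  ultimately show ?thesis
    by (simp add: faithful_correspondence_def bij_betw_def inter_closure_image[OF assms])
qed

lemma companions_canonical_skeleton: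
  assumes "pair_wf_digraph G" and "pair_wf_digraph H"
    and bij: "bij_betw \<phi> (pverts G) (pverts H)"
    and arc: "\<And>x y. x \<in> pverts G \<Longrightarrow> y \<in> pverts G \<Longrightarrow>
      (x, y) \<in> parcs G \<longleftrightarrow> (\<phi> x, \<phi> y) \<in> parcs H"
  shows "companions (pverts G) (canonical_skeleton G) (pverts H) (canonical_skeleton H)"
proof -
  have img: "\<phi> ` pverts G = pverts H" using bij by (rule bij_betw_imp_surj_on)
  \<comment> \<open>Preserving arcs gives one inclusion. Reflecting them gives the other, once a
    vertex of \<open>H\<close> is pulled back along the surjection \<open>\<phi>\<close>.\<close>
  have nbhd: "\<phi> ` out_nbhd G x = out_nbhd H (\<phi> x)" if x: "x \<in> pverts G" for x
  proof (intro equalityI subsetI)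
    fix w assume "w \<in> \<phi> ` out_nbhd G x"
    then show "w \<in> out_nbhd H (\<phi> x)"
      using arc[OF x] out_nbhd_subset[OF assms(1), of x] by (auto simp: out_nbhd_def)
  next
    fix w assume w: "w \<in> out_nbhd H (\<phi> x)"
    then obtain y where "y \<in> pverts G" "w = \<phi> y"
      using out_nbhd_subset[OF assms(2)] img by blast
    then show "w \<in> \<phi> ` out_nbhd G x"
      using arc[OF x] w by (auto simp: out_nbhd_def)
  qed
  have fam: "sk_family (canonical_skeleton H) = (`) \<phi> ` sk_family (canonical_skeleton G)"
    unfolding sk_family_canonical_skeleton img[symmetric] image_image
    by (rule image_cong) (simp_all add: nbhd)
  have "sk_family (canonical_skeleton G) \<subseteq> Pow (pverts G)"
    unfolding sk_family_canonical_skeleton using out_nbhd_subset[OF assms(1)] by auto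
  then have "faithful_correspondence ((`) \<phi>)
      (sk_family (canonical_skeleton G)) (sk_family (canonical_skeleton H))"
    unfolding fam by (rule faithful_correspondence_image[OF bij_betw_imp_inj_on[OF bij]])
  moreover have "\<phi> ` sk_set (canonical_skeleton G) (sk_map (canonical_skeleton G) x) =
      sk_set (canonical_skeleton H) (sk_map (canonical_skeleton H) (\<phi> x))"
    if "x \<in> pverts G" for x
    using bij_betwE[OF bij] that by (simp add: canonical_skeleton_def out_rep(2) nbhd)
  ultimately show ?thesis
    using bij unfolding companions_def by blast
qed

text \<open>The arcs leaving \<open>x\<close> are read off from the set assigned to
  \<open>x\<close>, and companionship carries this set onto the one assigned to
  \<open>\<phi> x\<close>.\<close>

lemma companions_arcs:
  assumes "is_skeleton V \<sigma>" and "companions V \<sigma> W \<tau>"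
  obtains \<phi> where "bij_betw \<phi> V W"
    and "\<And>x y. x \<in> V \<Longrightarrow> y \<in> V \<Longrightarrow>
      (x, y) \<in> parcs (skeleton_graph V \<sigma>) \<longleftrightarrow> (\<phi> x, \<phi> y) \<in> parcs (skeleton_graph W \<tau>)"
proof -
  from assms(2) obtain \<phi> where bij: "bij_betw \<phi> V W"
    and sets: "\<And>x. x \<in> V \<Longrightarrow> \<phi> ` sk_set \<sigma> (sk_map \<sigma> x) = sk_set \<tau> (sk_map \<tau> (\<phi> x))"
    unfolding companions_def by blast
  have "(x, y) \<in> parcs (skeleton_graph V \<sigma>) \<longleftrightarrow> (\<phi> x, \<phi> y) \<in> parcs (skeleton_graph W \<tau>)"
    if x: "x \<in> V" and y: "y \<in> V" for x y
  proof -
    \<comment> \<open>\<open>\<phi>\<close> is injective only on \<open>V\<close>, so reflecting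
      membership requires the set to lie inside \<open>V\<close>.\<close>
    have sub: "sk_set \<sigma> (sk_map \<sigma> x) \<subseteq> V"
      using assms(1) x unfolding is_skeleton_def sk_family_def by blast
    have "y \<in> sk_set \<sigma> (sk_map \<sigma> x) \<longleftrightarrow> \<phi> y \<in> sk_set \<tau> (sk_map \<tau> (\<phi> x))"
      unfolding sets[OF x, symmetric]
      using inj_on_image_mem_iff[OF bij_betw_imp_inj_on[OF bij] y sub] by simp
    then show ?thesis
      using x bij_betwE[OF bij] by (simp add: skeleton_graph_def)
  qed
  with bij show thesis by (rule that)
qed

theorem theorem3p9:
  fixes G :: "'a pair_pre_digraph" and G' :: "'b pair_pre_digraph"
  assumes "pair_fin_digraph G" and "pair_fin_digraph G'"
  shows "digraph_iso (with_proj G) (with_proj G') \<longleftrightarrow>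
    (\<exists>(\<sigma> :: 'a skeleton) (\<tau> :: 'b skeleton).
        is_skeleton (pverts G) \<sigma> \<and> is_skeleton (pverts G') \<tau> \<and>
        companions (pverts G) \<sigma> (pverts G') \<tau> \<and>
        G = skeleton_graph (pverts G) \<sigma> \<and> G' = skeleton_graph (pverts G') \<tau>)"
  (is "_ \<longleftrightarrow> ?R")
proof -
  interpret G: pair_fin_digraph G by fact
  interpret G': pair_fin_digraph G' by fact
  show ?thesis
    \<comment> \<open>Isomorphism becomes a vertex bijection preserving and reflecting arcs, the
      form in which the lemmas on companions are stated.\<close>
    unfolding digraph_iso_with_proj_iff[OF assms]
  proof (intro iffI; elim exE conjE)
    fix \<phi>
    assume "bij_betw \<phi> (pverts G) (pverts G')"
      and "\<forall>x\<in>pverts G. \<forall>y\<in>pverts G. (x, y) \<in> parcs G \<longleftrightarrow> (\<phi> x, \<phi> y) \<in> parcs G'"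
    then have "companions (pverts G) (canonical_skeleton G) (pverts G') (canonical_skeleton G')"
      by (intro companions_canonical_skeleton[where \<phi> = \<phi>]
          G.pair_wf_digraph_axioms G'.pair_wf_digraph_axioms) auto
    then show ?R
      by (intro exI[where x = "canonical_skeleton G"] exI[where x = "canonical_skeleton G'"])
        (simp add: assms is_skeleton_canonical_skeleton skeleton_graph_canonical_skeleton
          G.pair_wf_digraph_axioms G'.pair_wf_digraph_axioms)
  next
    fix \<sigma> :: "'a skeleton" and \<tau> :: "'b skeleton"
    assume sk: "is_skeleton (pverts G) \<sigma>" "companions (pverts G) \<sigma> (pverts G') \<tau>"
      and G: "G = skeleton_graph (pverts G) \<sigma>" and G': "G' = skeleton_graph (pverts G') \<tau>"
    show "\<exists>\<phi>. bij_betw \<phi> (pverts G) (pverts G') \<and>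
        (\<forall>x\<in>pverts G. \<forall>y\<in>pverts G. (x, y) \<in> parcs G \<longleftrightarrow> (\<phi> x, \<phi> y) \<in> parcs G')"
      \<comment> \<open>Folding turns the two skeleton graphs back into \<open>G\<close> and
        \<open>G'\<close>.\<close>
      by (rule companions_arcs[OF sk, folded G G']) blast
  qed
qed

end
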